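(* Suppose $W\in\mathcal{DT}(\mathbb T)$ is an operator with $\tau$-periodic matrix, $\tau\in\mathbb N$, i.e. $W_{k+\tau,j+\tau}=W_{k,j}$ for any $k,j\in\mathbb Z$. Then $W\in\mathcal R(\mathbb T)$ and for all $m,n\in\mathbb Z$ $$\omega_{m,n}=\frac1\tau\sum_{j\in\mathbb Z,\,l\in J}W_{l+m,j}\overline{W_{l,j+n}},$$ where $J\subset\mathbb Z$ is any interval of consecutive integers with $\#J=\tau$.
   Context: $\mathbb T=\mathbb R/2\pi\mathbb Z$ with measure $d\mu=dx/2\pi$. A bounded operator $W$ on $L^2(\mathbb T,\mu)$ has matrix $(W_{j,k})_{j,k\in\mathbb Z}$: $W\sum_kf_ke^{ikx}=\sum_{j,k}W_{j,k}f_ke^{ijx}$. $W\in\mathcal{DT}(\mathbb T)$ (diagonal type) means $c_k=\sup_j|W_{j+k,j}|<\infty$ for all $k\in\mathbb Z$ and $\sum_{k\in\mathbb Z}c_k<\infty$. $W$ is regular ($W\in\mathcal R(\mathbb T)$) if $W\in\mathcal{DT}(\mathbb T)$ and for all $m,n\in\mathbb Z$ the limit $\omega_{m,n}=\lim_{\#I\to\infty}\frac1{\#I}\sum_{j\in\mathbb Z,\,l\in I}W_{l+m,j}\overline{W_{l,j+n}}$ exists, where $I\subset\mathbb Z$ ranges over finite intervals of consecutive integers (limit over all such intervals, irrespective of position, as the number of elements $\#I\to\infty$). *)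

theory Defs
  imports "HOL-Analysis.Analysis"
begin

text \<open>
  The circle \<open>\<real>/2\<pi>\<int>\<close> is represented by its fundamental domain: the measure below is
  \<open>dx/2\<pi>\<close> on \<open>[0, 2\<pi>)\<close> and vanishes on the rest of the line. Almost everywhere statements
  and integrals therefore see a function only on \<open>[0, 2\<pi>)\<close>.
\<close>

definition circle :: "real measure" where
  "circle = uniform_measure lborel {0..<2 * pi}"

definition L2_circle :: "(real \<Rightarrow> complex) set" where
  "L2_circle = {f \<in> borel_measurable circle. integrable circle (\<lambda>x. (cmod (f x))\<^sup>2)}"

definition L2_norm_circle :: "(real \<Rightarrow> complex) \<Rightarrow> real" where
  "L2_norm_circle f = sqrt (integral\<^sup>L circle (\<lambda>x. (cmod (f x))\<^sup>2))"

text \<open>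
  Elements of the Hilbert space are given by representatives, so equations between them hold
  almost everywhere. Linearity and boundedness together imply that almost everywhere equal
  arguments have almost everywhere equal images, that is, that such a map acts on classes.
\<close>

definition bounded_operators_L2 :: "((real \<Rightarrow> complex) \<Rightarrow> (real \<Rightarrow> complex)) set" where
  "bounded_operators_L2 =
    {W. (\<forall>f \<in> L2_circle. W f \<in> L2_circle) \<and>
        (\<forall>f \<in> L2_circle. \<forall>g \<in> L2_circle. \<forall>a b :: complex.
           AE x in circle. W (\<lambda>y. a * f y + b * g y) x = a * W f x + b * W g x) \<and>
        (\<exists>C. \<forall>f \<in> L2_circle. L2_norm_circle (W f) \<le> C * L2_norm_circle f)}"

definition fourier_mode :: "int \<Rightarrow> real \<Rightarrow> complex" where
  "fourier_mode k x = exp (\<i> * of_int k * of_real x)"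

definition fourier_coeff :: "(real \<Rightarrow> complex) \<Rightarrow> int \<Rightarrow> complex" where
  "fourier_coeff f j = integral\<^sup>L circle (\<lambda>x. f x * cnj (fourier_mode j x))"

text \<open>
  \<open>W\<^sub>j\<^sub>,\<^sub>k\<close> is the coefficient of \<open>e\<^sup>i\<^sup>j\<^sup>x\<close> in the Fourier expansion
  \<open>W e\<^sup>i\<^sup>k\<^sup>x = \<Sum>\<^sub>j W\<^sub>j\<^sub>,\<^sub>k e\<^sup>i\<^sup>j\<^sup>x\<close>: the first index is the row.
\<close>

definition matrix_entry :: "((real \<Rightarrow> complex) \<Rightarrow> (real \<Rightarrow> complex)) \<Rightarrow> int \<Rightarrow> int \<Rightarrow> complex" where
  "matrix_entry W j k = fourier_coeff (W (fourier_mode k)) j"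

text \<open>Boundedness is stated separately because the supremum of an unbounded set of reals is
  an unspecified real number.\<close>

definition diagonal_type :: "((real \<Rightarrow> complex) \<Rightarrow> (real \<Rightarrow> complex)) set" where
  "diagonal_type =
    {W \<in> bounded_operators_L2.
       (\<forall>k. bdd_above (range (\<lambda>j. cmod (matrix_entry W (j + k) j)))) \<and>
       (\<lambda>k. SUP j. cmod (matrix_entry W (j + k) j)) summable_on UNIV}"

definition int_intervals :: "int set set" where
  "int_intervals = {{a..b} | a b. a \<le> b}"

text \<open>The limit over all finite integer intervals, wherever located, as their size grows.\<close>

definition long_intervals :: "int set filter" where
  "long_intervals = inf (filtercomap card at_top) (principal int_intervals)"

lemma eventually_long_intervals:
  "eventually P long_intervals \<longleftrightarrow> (\<exists>N. \<forall>I \<in> int_intervals. N \<le> card I \<longrightarrow> P I)"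
  unfolding long_intervals_def eventually_inf_principal
    eventually_filtercomap_at_top_linorder by blast

lemma long_intervals_neq_bot: "long_intervals \<noteq> bot"
proof
  assume "long_intervals = bot"
  then have "eventually (\<lambda>_. False) long_intervals" by simp
  then obtain N where N: "\<forall>I \<in> int_intervals. \<not> N \<le> card I"
    unfolding eventually_long_intervals by blast
  have "{0..int N} \<in> int_intervals" unfolding int_intervals_def by force
  with N show False by force
qed

text \<open>For \<open>W\<close> of diagonal type the family below is absolutely summable, since
  \<open>\<bar>W\<^sub>l\<^sub>+\<^sub>m\<^sub>,\<^sub>j\<bar>\<close> is at most \<open>c\<^sub>l\<^sub>+\<^sub>m\<^sub>-\<^sub>j\<close> and all entries are uniformly bounded.\<close>

definition correlation_sum ::
    "((real \<Rightarrow> complex) \<Rightarrow> (real \<Rightarrow> complex)) \<Rightarrow> int \<Rightarrow> int \<Rightarrow> int set \<Rightarrow> complex" where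
  "correlation_sum W m n I =
    (\<Sum>\<^sub>\<infinity>(j, l) \<in> UNIV \<times> I. matrix_entry W (l + m) j * cnj (matrix_entry W l (j + n)))"

definition regular_operators :: "((real \<Rightarrow> complex) \<Rightarrow> (real \<Rightarrow> complex)) set" where
  "regular_operators =
    {W \<in> diagonal_type. \<forall>m n. \<exists>z.
       ((\<lambda>I. correlation_sum W m n I / of_nat (card I)) \<longlongrightarrow> z) long_intervals}"

definition omega :: "((real \<Rightarrow> complex) \<Rightarrow> (real \<Rightarrow> complex)) \<Rightarrow> int \<Rightarrow> int \<Rightarrow> complex" where
  "omega W m n = Lim long_intervals (\<lambda>I. correlation_sum W m n I / of_nat (card I))"

end

theory Submission
  imports Defs
begin

text \<open>
  Summing over the column index \<open>j\<close> first turns the correlation sum over an interval \<open>I\<close> into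
  \<open>\<Sum>l\<in>I. F l\<close>, where \<open>F l\<close> is the correlation of the rows \<open>l + m\<close> and \<open>l\<close>; the diagonal type
  condition makes these row correlations converge absolutely. Replacing \<open>l\<close> by \<open>l + \<tau>\<close> and the
  summation index \<open>j\<close> by \<open>j + \<tau>\<close> shows that \<open>F\<close> inherits the period \<open>\<tau>\<close> of the matrix.

  What remains is elementary: an interval of integers consists of full periods, each
  contributing the same window sum, and of fewer than \<open>\<tau>\<close> further points. The sum of \<open>F\<close> over
  \<open>I\<close> thus differs from \<open>card I / \<tau>\<close> times the window sum by an amount bounded independently
  of \<open>I\<close> (\<open>periodic_sum_discrepancy\<close>), and dividing by \<open>card I\<close> gives convergence,
  irrespective of the position of \<open>I\<close> (\<open>periodic_mean_tendsto\<close>).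
\<close>

section \<open>Means of periodic functions over long intervals\<close>

lemma int_intervalsE:
  assumes "I \<in> int_intervals"
  obtains a where "I = {a..<a + int (card I)}"
proof -
  from assms obtain a b where ab: "I = {a..b}" "a \<le> b"
    unfolding int_intervals_def by blast
  then have "I = {a..<a + int (card I)}" by auto
  then show ?thesis by (rule that)
qed

lemma periodic_window_sum:
  fixes F :: "int \<Rightarrow> 'a::ab_group_add"
  assumes per: "\<And>l. F (l + int t) = F l"
  shows "sum F {a..<a + int t} = sum F {b..<b + int t}"
proof -
  \<comment> \<open>Sliding the window by one exchanges the value at one end for an equal one at the other.\<close>
  have step: "sum F {a + 1..<a + 1 + int t} = sum F {a..<a + int t}" for a
  proof -
    have "insert a {a + 1..<a + 1 + int t} = insert (a + int t) {a..<a + int t}" by auto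
    then have "sum F (insert a {a + 1..<a + 1 + int t}) =
        sum F (insert (a + int t) {a..<a + int t})" by (rule arg_cong)
    then show ?thesis using per[of a] by simp
  qed
  have "sum F {a..<a + int t} = sum F {0..<0 + int t}" for a
  proof (induction a rule: int_induct[where k = 0])
    case base
    show ?case ..
  next
    case (step1 i)
    then show ?case using step[of i] by simp
  next
    case (step2 i)
    then show ?case using step[of "i - 1"] by simp
  qed
  then show ?thesis by simp
qed

lemma periodic_bounded:
  fixes F :: "int \<Rightarrow> 'a::real_normed_vector"
  assumes "t \<ge> 1" and per: "\<And>l. F (l + int t) = F l"
  obtains B where "\<And>l. norm (F l) \<le> B"
proof -
  have shift: "F (l + int t * k) = F l" for l k
  proof (induction k rule: int_induct[where k = 0])
    case base
    show ?case by simp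
  next
    case (step1 i)
    then show ?case using per[of "l + int t * i"] by (simp add: algebra_simps)
  next
    case (step2 i)
    then show ?case using per[of "l + int t * (i - 1)"] by (simp add: algebra_simps)
  qed
  have "norm (F l) \<le> (\<Sum>i\<in>{0..<int t}. norm (F i))" for l
  proof -
    have "F l = F (l mod int t)"
      using shift[of "l mod int t" "l div int t"] by simp
    then show ?thesis
      using assms(1) by (auto intro!: member_le_sum)
  qed
  then show ?thesis by (rule that)
qed

text \<open>Removing a full period lowers the sum by \<open>S\<close> and the number of points by \<open>t\<close>, so the
  discrepancy depends only on the remaining points, of which there are fewer than \<open>t\<close>.\<close>

lemma periodic_sum_discrepancy:
  fixes F :: "int \<Rightarrow> 'a::real_normed_field"
  assumes t: "t \<ge> 1"
    and S: "\<And>a. sum F {a..<a + int t} = S"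
    and B: "\<And>l. norm (F l) \<le> B"
  shows "norm (sum F {a..<a + int N} - of_nat N * (S / of_nat t)) \<le> real t * B + norm S"
proof (induction N arbitrary: a rule: less_induct)
  case (less N)
  have t0: "(of_nat t :: 'a) \<noteq> 0" using t by simp
  have B0: "0 \<le> B" using order_trans[OF norm_ge_zero B] .
  show ?case
  proof (cases "N < t")
    case True
    have "norm (sum F {a..<a + int N}) \<le> (\<Sum>l\<in>{a..<a + int N}. B)"
      by (intro sum_norm_le B)
    also have "\<dots> = real N * B" by simp
    also have "\<dots> \<le> real t * B" using True B0 by (intro mult_right_mono) auto
    finally have 1: "norm (sum F {a..<a + int N}) \<le> real t * B" .
    have "norm (of_nat N * (S / of_nat t)) = (real N / real t) * norm S"
      by (simp add: norm_mult norm_divide)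
    also have "\<dots> \<le> 1 * norm S" using True t by (intro mult_right_mono) auto
    finally have 2: "norm (of_nat N * (S / of_nat t)) \<le> norm S" by simp
    show ?thesis using norm_triangle_ineq4 1 2 add_mono order_trans by blast
  next
    case False
    then obtain M where M: "N = t + M" using le_Suc_ex not_less by blast
    have "{a..<a + int N} = {a..<a + int t} \<union> {a + int t..<a + int t + int M}"
      using M by auto
    then have "sum F {a..<a + int N} = S + sum F {a + int t..<a + int t + int M}"
      by (simp add: sum.union_disjoint S)
    then have "sum F {a..<a + int N} - of_nat N * (S / of_nat t) =
        sum F {a + int t..<a + int t + int M} - of_nat M * (S / of_nat t)"
      using t0 M by (simp add: field_simps)
    moreover have "M < N" using M t by simp
    ultimately show ?thesis using less.IH by metis
  qed
qed

lemma periodic_mean_tendsto: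
  fixes F :: "int \<Rightarrow> 'a::real_normed_field"
  assumes t: "t \<ge> 1" and per: "\<And>l. F (l + int t) = F l"
    and J: "J \<in> int_intervals" "card J = t"
  shows "((\<lambda>I. sum F I / of_nat (card I)) \<longlongrightarrow> sum F J / of_nat t) long_intervals"
proof -
  define S where "S = sum F J"
  obtain b where "J = {b..<b + int t}" using int_intervalsE[OF J(1)] J(2) by metis
  then have S: "sum F {a..<a + int t} = S" for a
    using periodic_window_sum[of F t, OF per] S_def by metis
  obtain B where B: "\<And>l. norm (F l) \<le> B" using periodic_bounded[of t F, OF t per] by blast
  define C where "C = real t * B + norm S"
  have card_top: "filterlim (\<lambda>I. card I) at_top long_intervals"
    unfolding long_intervals_def
    by (rule filterlim_mono[OF filterlim_filtercomap]) auto
  have lim0: "((\<lambda>I. C / real (card I)) \<longlongrightarrow> 0) long_intervals"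
    by (intro tendsto_divide_0[OF tendsto_const] filterlim_at_top_imp_at_infinity
        filterlim_compose[OF filterlim_real_sequentially card_top])
  have "norm (sum F I / of_nat (card I) - S / of_nat t) \<le> C / real (card I)"
    if I: "I \<in> int_intervals" "1 \<le> card I" for I
  proof -
    have c: "(of_nat (card I) :: 'a) \<noteq> 0" using I(2) by simp
    obtain a where a: "I = {a..<a + int (card I)}" using int_intervalsE[OF I(1)] .
    have "norm (sum F I - of_nat (card I) * (S / of_nat t)) \<le> C"
      unfolding C_def using periodic_sum_discrepancy[of t F S B a "card I", OF t S B] a by simp
    moreover have "sum F I / of_nat (card I) - S / of_nat t =
        (sum F I - of_nat (card I) * (S / of_nat t)) / of_nat (card I)"
      unfolding diff_divide_distrib using c by simp
    ultimately show ?thesis by (simp add: norm_divide divide_right_mono)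
  qed
  then have "\<forall>\<^sub>F I in long_intervals.
      norm (sum F I / of_nat (card I) - S / of_nat t) \<le> C / real (card I)"
    unfolding eventually_long_intervals by blast
  then have "((\<lambda>I. sum F I / of_nat (card I) - S / of_nat t) \<longlongrightarrow> 0) long_intervals"
    using lim0 by (rule Lim_null_comparison)
  then show ?thesis unfolding S_def by (rule LIM_zero_cancel)
qed

section \<open>Row correlations of a diagonal type operator\<close>

lemma has_sum_times_finite:
  fixes f :: "'a \<Rightarrow> 'b \<Rightarrow> 'c::{topological_comm_monoid_add}"
  assumes "finite I" and "\<And>l. l \<in> I \<Longrightarrow> ((\<lambda>j. f j l) has_sum F l) A"
  shows "((\<lambda>(j, l). f j l) has_sum (\<Sum>l\<in>I. F l)) (A \<times> I)"
  using assms
proof (induction I rule: finite_induct)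
  case empty
  show ?case by simp
next
  case (insert l I)
  have "((\<lambda>(j, l). f j l) has_sum F l) ((\<lambda>j. (j, l)) ` A)"
    using insert.prems[of l]
    by (subst has_sum_reindex) (auto simp: inj_on_def o_def)
  moreover have "(\<lambda>j. (j, l)) ` A = A \<times> {l}" by auto
  ultimately have "((\<lambda>(j, l). f j l) has_sum (F l + (\<Sum>l\<in>I. F l))) (A \<times> {l} \<union> A \<times> I)"
    using insert by (intro has_sum_Un_disjoint) auto
  moreover have "A \<times> {l} \<union> A \<times> I = A \<times> insert l I" by auto
  ultimately show ?case using insert.hyps by simp
qed

text \<open>Along a fixed row the entries are dominated by the reflected summable family of
  diagonal suprema.\<close>

lemma diagonal_type_row_abs_summable:
  assumes "W \<in> diagonal_type"
  shows "(\<lambda>j. cmod (matrix_entry W k j)) summable_on UNIV"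
proof -
  define c where "c = (\<lambda>k. SUP j. cmod (matrix_entry W (j + k) j))"
  have c: "c summable_on UNIV"
    and bdd: "\<And>k. bdd_above (range (\<lambda>j. cmod (matrix_entry W (j + k) j)))"
    using assms unfolding diagonal_type_def c_def by auto
  have "bij_betw (\<lambda>j. k - j) UNIV (UNIV :: int set)"
    by (rule bij_betwI[where g = "\<lambda>j. k - j"]) auto
  then have "(\<lambda>j. c (k - j)) summable_on UNIV"
    using c summable_on_reindex_bij_betw[of "\<lambda>j. k - j" UNIV UNIV c] by simp
  moreover have "cmod (matrix_entry W k j) \<le> c (k - j)" for j
    using cSUP_upper[OF UNIV_I bdd[of "k - j"], of j] unfolding c_def by simp
  ultimately show ?thesis
    by (rule summable_on_comparison_test) auto
qed

lemma summable_on_mult_abs: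
  fixes x y :: "'a \<Rightarrow> complex"
  assumes x: "(\<lambda>j. cmod (x j)) summable_on A" and y: "(\<lambda>j. cmod (y j)) summable_on A"
  shows "(\<lambda>j. x j * y j) summable_on A"
proof -
  \<comment> \<open>One summable factor only has to be bounded, by its total sum.\<close>
  have "cmod (y j) \<le> (\<Sum>\<^sub>\<infinity>j\<in>A. cmod (y j))" if "j \<in> A" for j
    using finite_sum_le_infsum[OF y, of "{j}"] that by simp
  then have "norm (x j * y j) \<le> cmod (x j) * (\<Sum>\<^sub>\<infinity>j\<in>A. cmod (y j))" if "j \<in> A" for j
    using that by (simp add: norm_mult mult_left_mono)
  then have "(\<lambda>j. norm (x j * y j)) summable_on A"
    by (intro summable_on_comparison_test[OF summable_on_cmult_left[OF x]]) auto
  then show ?thesis by (rule abs_summable_summable)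
qed

definition row_correlation ::
    "((real \<Rightarrow> complex) \<Rightarrow> (real \<Rightarrow> complex)) \<Rightarrow> int \<Rightarrow> int \<Rightarrow> int \<Rightarrow> complex" where
  "row_correlation W m n l =
    (\<Sum>\<^sub>\<infinity>j. matrix_entry W (l + m) j * cnj (matrix_entry W l (j + n)))"

lemma correlation_sum_eq_sum_rows:
  assumes W: "W \<in> diagonal_type" and "finite I"
  shows "correlation_sum W m n I = (\<Sum>l\<in>I. row_correlation W m n l)"
proof -
  have "(\<lambda>j. matrix_entry W (l + m) j * cnj (matrix_entry W l (j + n))) summable_on UNIV" for l
  proof -
    have "bij_betw (\<lambda>j. j + n) UNIV (UNIV :: int set)"
      by (rule bij_betwI[where g = "\<lambda>j. j - n"]) auto
    then have "(\<lambda>j. cmod (matrix_entry W l (j + n))) summable_on UNIV"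
      using diagonal_type_row_abs_summable[OF W, of l]
        summable_on_reindex_bij_betw[of "\<lambda>j. j + n" UNIV UNIV "\<lambda>j. cmod (matrix_entry W l j)"]
      by simp
    then show ?thesis
      by (intro summable_on_mult_abs diagonal_type_row_abs_summable[OF W]) simp
  qed
  then show ?thesis
    unfolding correlation_sum_def row_correlation_def
    by (intro infsumI has_sum_times_finite has_sum_infsum assms)
qed

lemma row_correlation_periodic:
  assumes per: "\<And>k j :: int. matrix_entry W (k + p) (j + p) = matrix_entry W k j"
  shows "row_correlation W m n (l + p) = row_correlation W m n l"
proof -
  have bij: "bij_betw (\<lambda>j. j + p) UNIV (UNIV :: int set)"
    by (rule bij_betwI[where g = "\<lambda>j. j - p"]) auto
  have "row_correlation W m n (l + p) =
      (\<Sum>\<^sub>\<infinity>j. matrix_entry W (l + p + m) (j + p) * cnj (matrix_entry W (l + p) (j + p + n)))"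
    unfolding row_correlation_def by (rule infsum_reindex_bij_betw[OF bij, symmetric])
  also have "\<dots> = row_correlation W m n l"
    unfolding row_correlation_def
    using per[of "l + m"] per[of l "j + n" for j] by (simp add: ac_simps)
  finally show ?thesis .
qed

section \<open>Regularity of operators with periodic matrix\<close>

theorem lemma5p1:
  fixes W :: "(real \<Rightarrow> complex) \<Rightarrow> (real \<Rightarrow> complex)" and \<tau> :: nat
  assumes "W \<in> diagonal_type"
    and "\<tau> \<ge> 1"
    and "\<And>k j :: int. matrix_entry W (k + int \<tau>) (j + int \<tau>) = matrix_entry W k j"
  shows "W \<in> regular_operators \<and>
    (\<forall>m n :: int. \<forall>J \<in> int_intervals. card J = \<tau> \<longrightarrow>
       omega W m n =
         1 / of_nat \<tau> *
           (\<Sum>\<^sub>\<infinity>(j, l) \<in> UNIV \<times> J. matrix_entry W (l + m) j * cnj (matrix_entry W l (j + n))))"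
proof -
  have mean: "((\<lambda>I. correlation_sum W m n I / of_nat (card I))
      \<longlongrightarrow> correlation_sum W m n J / of_nat \<tau>) long_intervals"
    if J: "J \<in> int_intervals" "card J = \<tau>" for m n J
  proof -
    have rows: "correlation_sum W m n I = sum (row_correlation W m n) I"
      if "I \<in> int_intervals" for I
      using that by (intro correlation_sum_eq_sum_rows[OF assms(1)]) (auto simp: int_intervals_def)
    have "((\<lambda>I. sum (row_correlation W m n) I / of_nat (card I))
        \<longlongrightarrow> correlation_sum W m n J / of_nat \<tau>) long_intervals"
      unfolding rows[OF J(1)]
      by (intro periodic_mean_tendsto assms(2) row_correlation_periodic assms(3) J)
    moreover have "\<forall>\<^sub>F I in long_intervals. sum (row_correlation W m n) I / of_nat (card I) =
        correlation_sum W m n I / of_nat (card I)"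
      unfolding eventually_long_intervals using rows by auto
    ultimately show ?thesis by (rule Lim_transform_eventually)
  qed
  have "\<exists>z. ((\<lambda>I. correlation_sum W m n I / of_nat (card I)) \<longlongrightarrow> z) long_intervals" for m n
  proof -
    have "{1..int \<tau>} \<in> int_intervals" "card {1..int \<tau>} = \<tau>"
      using assms(2) by (force simp: int_intervals_def)+
    then show ?thesis using mean by blast
  qed
  then have "W \<in> regular_operators"
    unfolding regular_operators_def using assms(1) by blast
  moreover have "omega W m n = 1 / of_nat \<tau> * correlation_sum W m n J"
    if "J \<in> int_intervals" "card J = \<tau>" for m n J
    unfolding omega_def using tendsto_Lim[OF long_intervals_neq_bot mean[OF that]] by simp
  ultimately show ?thesis unfolding correlation_sum_def by blast
qed

end
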